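(* Let $2\le k\le n$, let $\Omega\subset\mathbb{R}^n$ be a bounded domain, $\mathcal{D}=\overline{\Omega}\times\mathbb{R}\times\mathbb{R}^n$. Suppose $A(x,z,p)$ (symmetric matrix valued) and $f(x,z,p)$ are continuous on $\mathcal{D}$, $f>0$ on $\mathcal{D}$, and $B(x,z,p)$ (skew-symmetric matrix valued) is bounded and continuous on $\mathcal{D}$. Let $u\in C^2(\overline{\Omega})$ be a strictly admissible solution of $$S_k\big(D^2u-A(x,u,Du)-B(x,u,Du)\big)=f(x,u,Du)\quad\text{in }\overline{\Omega},$$ and suppose there exist $M_0,M_1>0$ with $\sup_{\overline{\Omega}}|u|\le M_0$, $\sup_{\overline{\Omega}}|Du|\le M_1$. Set $$f_0=\inf_{x\in\overline\Omega,\ |z|\le M_0,\ |p|\le M_1} f(x,z,p),\qquad f_1=\sup_{x\in\overline\Omega,\ |z|\le M_0,\ |p|\le M_1} f(x,z,p).$$ Then for every $x\in\overline{\Omega}$: (i) $0<\lambda_{\min}(\omega(x,u))\le \big[f_1/\binom{n}{k}\big]^{1/k}$; (ii) if $u$ is $\delta$-admissible ($0<\delta<1$), then in addition $\big[(1+\delta^2)^{-[k/2]}f_0/\binom{n}{k}\big]^{1/k}\le \lambda_{\max}(\omega(x,u))$; (iii) if $u$ is $\widetilde\gamma_k$-admissible ($0<\widetilde\gamma_k<1$), then in addition $\lambda_{\max}(\omega(x,u))\le \frac{1}{\widetilde\gamma_k}\big[f_1/\binom{n}{k}\big]^{1/k}$; (iv) if $u$ is $(\delta,\widetilde\gamma_k)$-admissible,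 then $$\widetilde\gamma_k\Big[\tfrac{(1+\delta^2)^{-[k/2]}f_0}{\binom nk}\Big]^{1/k}\le\lambda_{\min}(\omega(x,u))\le\Big[\tfrac{f_1}{\binom nk}\Big]^{1/k},\qquad \Big[\tfrac{(1+\delta^2)^{-[k/2]}f_0}{\binom nk}\Big]^{1/k}\le\lambda_{\max}(\omega(x,u))\le\tfrac{1}{\widetilde\gamma_k}\Big[\tfrac{f_1}{\binom nk}\Big]^{1/k}.$$
   Context: For $R\in\mathbb{R}^{n\times n}$, $S_k(R)=\sigma_k(\lambda(R))$, where $\lambda(R)\in\mathbb{C}^n$ are the eigenvalues of $R$ and $\sigma_k(\lambda)=\sum_{1\le i_1<\dots<i_k\le n}\lambda_{i_1}\cdots\lambda_{i_k}$ (equivalently, the sum of the principal $k\times k$ minors of $R$). $[a]$ denotes the integer part. For $u\in C^2(\overline\Omega)$ set $\omega(x,u)=D^2u(x)-A(x,u(x),Du(x))$ (symmetric) and $R(x,u)=\omega(x,u)-B(x,u(x),Du(x))$. Set $\lambda_u=\inf_{x\in\overline\Omega}\lambda_{\min}(\omega(x,u))$, $\gamma_u=\inf_{x\in\overline\Omega}\lambda_{\min}(\omega(x,u))/\lambda_{\max}(\omega(x,u))$, and $\mu(B)=\sup_{\mathcal D}\|B(x,z,p)\|$ (operator norm). A function $u\in C^2(\overline\Omega)$ is strictly admissible if $\lambda_u>0$; $\delta$-admissible ($0<\delta<1$) if strictly admissible and $\mu(B)\le\delta\lambda_u$; $\widetilde\gamma_k$-admissible ($0<\widetilde\gamma_k<1$)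 if strictly admissible and $\gamma_u\ge\widetilde\gamma_k$; $(\delta,\widetilde\gamma_k)$-admissible if both $\delta$-admissible and $\widetilde\gamma_k$-admissible. *)

theory Defs
  imports "HOL-Analysis.Analysis"
begin

text \<open>Determinant of the principal submatrix of R indexed by I (Leibniz formula).\<close>
definition principal_minor :: "real^'n^'n \<Rightarrow> 'n set \<Rightarrow> real" where
  "principal_minor R I =
     (\<Sum>p\<in>{p. p permutes I}. of_int (sign p) * (\<Prod>i\<in>I. R $ i $ p i))"

text \<open>S_k(R): sum of the principal k x k minors of R (= sigma_k of the eigenvalues).\<close>
definition S_k :: "nat \<Rightarrow> real^'n^'n \<Rightarrow> real" where
  "S_k k R = (\<Sum>I\<in>{I::'n set. card I = k}. principal_minor R I)"

text \<open>Real eigenvalues of a real square matrix.\<close>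
definition real_eigenvalues :: "real^'n^'n \<Rightarrow> real set" where
  "real_eigenvalues M = {l. \<exists>v. v \<noteq> 0 \<and> M *v v = l *\<^sub>R v}"

definition lambda_min :: "real^'n^'n \<Rightarrow> real" where
  "lambda_min M = Min (real_eigenvalues M)"

definition lambda_max :: "real^'n^'n \<Rightarrow> real" where
  "lambda_max M = Max (real_eigenvalues M)"

text \<open>lambda_u and gamma_u for the matrix field W x = omega(x,u) over the set S (= closure Omega).\<close>
definition lambda_u :: "(real^'n) set \<Rightarrow> (real^'n \<Rightarrow> real^'n^'n) \<Rightarrow> real" where
  "lambda_u S W = (INF x\<in>S. lambda_min (W x))"

definition gamma_u :: "(real^'n) set \<Rightarrow> (real^'n \<Rightarrow> real^'n^'n) \<Rightarrow> real" where
  "gamma_u S W = (INF x\<in>S. lambda_min (W x) / lambda_max (W x))"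

text \<open>mu(B) = sup over the domain D of the operator norm of B.\<close>
definition mu_B :: "((real^'n) \<times> real \<times> (real^'n)) set \<Rightarrow>
    (real^'n \<Rightarrow> real \<Rightarrow> real^'n \<Rightarrow> real^'n^'n) \<Rightarrow> real" where
  "mu_B D B = (SUP t\<in>D. onorm (\<lambda>v. (case t of (x, z, p) \<Rightarrow> B x z p) *v v))"

definition strictly_admissible :: "(real^'n) set \<Rightarrow> (real^'n \<Rightarrow> real^'n^'n) \<Rightarrow> bool" where
  "strictly_admissible S W \<longleftrightarrow> lambda_u S W > 0"

definition delta_admissible :: "real \<Rightarrow> (real^'n) set \<Rightarrow> (real^'n \<Rightarrow> real^'n^'n) \<Rightarrow>
    (real^'n \<Rightarrow> real \<Rightarrow> real^'n \<Rightarrow> real^'n^'n) \<Rightarrow> bool" where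
  "delta_admissible \<delta> S W B \<longleftrightarrow>
     strictly_admissible S W \<and> mu_B (S \<times> UNIV \<times> UNIV) B \<le> \<delta> * lambda_u S W"

definition gamma_admissible :: "real \<Rightarrow> (real^'n) set \<Rightarrow> (real^'n \<Rightarrow> real^'n^'n) \<Rightarrow> bool" where
  "gamma_admissible g S W \<longleftrightarrow> strictly_admissible S W \<and> gamma_u S W \<ge> g"

end

theory Submission
  imports Defs "Jordan_Normal_Form.Char_Poly"
begin

(* On the closure of the domain, W = D^2 u - A(x, u, Du) is symmetric (Schwarz's theorem plus
   continuity) and B is skew, so W - B has the same quadratic form as W.  A principal k x k minor
   of W - B is the product of the complex eigenvalues of the principal submatrix, and each of
   them is a Rayleigh value z* (W - B) z / z* z: its real part lies in
   [lambda_min W, lambda_max W] and its imaginary part is bounded by the operator norm of B,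
   hence by delta lambda_min W when u is delta-admissible.  So every minor is at least
   lambda_min^k (a homotopy to the symmetric part fixes its sign) and at most
   (1 + delta^2)^[k/2] lambda_max^k (for odd k one eigenvalue is real).  Summing the C(n, k)
   minors and comparing with f0 <= S_k = f <= f1 gives the bounds; gamma-admissibility
   transfers them between lambda_min and lambda_max. *)

section \<open>Quadratic forms and extremal eigenvalues\<close>

lemma matrix_vector_mult_uminus_left: "(- N) *v x = - (N *v x)" for N :: "real^'n^'n"
  using matrix_vector_mult_diff_rdistrib[of 0 N x] by simp

lemma transpose_uminus: "transpose (- A) = - transpose A" for A :: "real^'n^'m"
  by (simp add: transpose_def Finite_Cartesian_Product.vec_eq_iff)

lemma transpose_diff: "transpose (A - B) = transpose A - transpose B" for A B :: "real^'n^'m"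
  by (simp add: transpose_def Finite_Cartesian_Product.vec_eq_iff)

lemma inner_transpose_matrix_vector: "x \<bullet> (transpose N *v y) = y \<bullet> (N *v x)"
  for N :: "real^'n^'n"
  by (simp add: dot_lmul_matrix[symmetric] inner_commute)

lemma inner_symmetric_matrix_vector:
  "transpose W = W \<Longrightarrow> x \<bullet> (W *v y) = y \<bullet> (W *v x)" for W :: "real^'n^'n"
  by (metis inner_transpose_matrix_vector)

lemma inner_skew_matrix_vector:
  "transpose B = - B \<Longrightarrow> x \<bullet> (B *v y) = - (y \<bullet> (B *v x))" for B :: "real^'n^'n"
  by (metis inner_transpose_matrix_vector inner_minus_right matrix_vector_mult_uminus_left)

lemma quadratic_form_skew: "transpose B = - B \<Longrightarrow> x \<bullet> (B *v x) = 0" for B :: "real^'n^'n"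
  using inner_skew_matrix_vector[of B x x] by simp

lemma quadratic_form_diff_skew:
  fixes W B :: "real^'n^'n"
  shows "transpose B = - B \<Longrightarrow> x \<bullet> ((W - B) *v x) = x \<bullet> (W *v x)"
  by (simp add: matrix_vector_mult_diff_rdistrib inner_diff_right quadratic_form_skew)

lemma finite_real_eigenvalues_symmetric:
  fixes W :: "real^'n^'n"
  assumes sym: "transpose W = W"
  shows "finite (real_eigenvalues W)"
proof -
  define v where "v l = (SOME v. v \<noteq> 0 \<and> W *v v = l *\<^sub>R v)" for l
  have v: "v l \<noteq> 0 \<and> W *v v l = l *\<^sub>R v l" if "l \<in> real_eigenvalues W" for l
    using that unfolding real_eigenvalues_def v_def by (metis (mono_tags, lifting) someI_ex mem_Collect_eq)
  have orth: "v l \<bullet> v l' = 0" if "l \<in> real_eigenvalues W" "l' \<in> real_eigenvalues W" "l \<noteq> l'" for l l'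
  proof -
    have "l * (v l' \<bullet> v l) = v l' \<bullet> (W *v v l)" using v[OF that(1)] by simp
    also have "\<dots> = v l \<bullet> (W *v v l')" by (rule inner_symmetric_matrix_vector[OF sym])
    also have "\<dots> = l' * (v l \<bullet> v l')" using v[OF that(2)] by simp
    finally have "(l - l') * (v l \<bullet> v l') = 0" by (simp add: inner_commute algebra_simps)
    thus ?thesis using that(3) by simp
  qed
  have "inj_on v (real_eigenvalues W)"
    by (rule inj_onI) (metis orth v inner_eq_zero_iff)
  moreover have "independent (v ` real_eigenvalues W)"
  proof (rule pairwise_orthogonal_independent)
    show "pairwise Linear_Algebra.orthogonal (v ` real_eigenvalues W)"
      unfolding pairwise_def Linear_Algebra.orthogonal_def using orth by auto
    show "0 \<notin> v ` real_eigenvalues W" using v by force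
  qed
  ultimately show ?thesis using finiteI_independent finite_imageD by blast
qed

text \<open>A vector attaining the lower Rayleigh bound is an eigenvector: perturbing it along the
  residual g = W x - \<mu> x decreases the Rayleigh quotient to first order unless g = 0.\<close>

lemma rayleigh_minimizer_eigenvector:
  fixes W :: "real^'n^'n"
  assumes sym: "transpose W = W"
    and lower: "\<And>y. \<mu> * (y \<bullet> y) \<le> y \<bullet> (W *v y)"
    and attained: "x \<bullet> (W *v x) = \<mu> * (x \<bullet> x)"
  shows "W *v x = \<mu> *\<^sub>R x"
proof -
  define g where "g = W *v x - \<mu> *\<^sub>R x"
  define G where "G = g \<bullet> g"
  define Q where "Q = g \<bullet> (W *v g) - \<mu> * G"
  have Q: "0 \<le> Q" using lower[of g] by (simp add: Q_def G_def)
  have perturb: "2 * s * G \<le> s\<^sup>2 * Q" for s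
  proof -
    have "\<mu> * ((x - s *\<^sub>R g) \<bullet> (x - s *\<^sub>R g)) \<le> (x - s *\<^sub>R g) \<bullet> (W *v (x - s *\<^sub>R g))"
      by (rule lower)
    moreover have "g \<bullet> (W *v x) = x \<bullet> (W *v g)" by (rule inner_symmetric_matrix_vector[OF sym])
    moreover have "g \<bullet> (W *v x) - \<mu> * (g \<bullet> x) = G" by (simp add: G_def g_def inner_diff_right)
    ultimately show ?thesis using attained
      by (simp add: Q_def G_def matrix_vector_mult_diff_distrib matrix_vector_mult_scaleR inner_diff_left
          inner_diff_right inner_commute power2_eq_square algebra_simps)
  qed
  have "G = 0"
  proof (rule ccontr)
    assume "G \<noteq> 0"
    hence G: "0 < G" by (simp add: G_def order_less_le)
    define s where "s = G / (Q + 1)"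
    have s: "0 < s" using G Q by (simp add: s_def)
    have "2 * s * G \<le> s * (s * Q)" using perturb[of s] by (simp add: power2_eq_square)
    hence "2 * G \<le> s * Q" using s by simp
    also have "s * Q < G" using G Q by (simp add: s_def field_simps)
    finally show False using G by simp
  qed
  thus ?thesis by (simp add: G_def g_def)
qed

lemma symmetric_matrix_min_eigenvalue:
  fixes W :: "real^'n^'n"
  assumes sym: "transpose W = W"
  obtains \<mu> where "\<mu> \<in> real_eigenvalues W" "\<And>x. \<mu> * (x \<bullet> x) \<le> x \<bullet> (W *v x)"
proof -
  define q where "q x = x \<bullet> (W *v x)" for x :: "real^'n"
  have "continuous_on (sphere 0 1) q"
    unfolding q_def by (intro continuous_intros linear_continuous_on matrix_vector_mul_bounded_linear)
  moreover have "sphere (0::real^'n) 1 \<noteq> {}" using vector_choose_size[of 1] by auto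
  ultimately obtain x0 where x0: "x0 \<in> sphere 0 1" and min: "\<And>y. y \<in> sphere 0 1 \<Longrightarrow> q x0 \<le> q y"
    using continuous_attains_inf[OF compact_sphere] by blast
  have lower: "q x0 * (y \<bullet> y) \<le> q y" for y
  proof (cases "y = 0")
    case False
    have "q x0 \<le> q ((1 / norm y) *\<^sub>R y)" using False by (intro min) simp
    also have "\<dots> = q y / (y \<bullet> y)"
      by (simp add: q_def matrix_vector_mult_scaleR power2_norm_eq_inner[symmetric] power2_eq_square)
    finally show ?thesis using False by (simp add: pos_le_divide_eq)
  qed (simp add: q_def)
  have "x0 \<bullet> x0 = 1" using x0 by (simp add: dot_square_norm)
  hence "W *v x0 = q x0 *\<^sub>R x0"
    using rayleigh_minimizer_eigenvector[OF sym lower[unfolded q_def]] by (simp add: q_def)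
  moreover have "x0 \<noteq> 0" using x0 by auto
  ultimately have "q x0 \<in> real_eigenvalues W" unfolding real_eigenvalues_def by blast
  thus thesis using that lower unfolding q_def by blast
qed

lemma rayleigh_lower_le_eigenvalue:
  fixes W :: "real^'n^'n"
  assumes "\<And>x. \<mu> * (x \<bullet> x) \<le> x \<bullet> (W *v x)" and "l \<in> real_eigenvalues W"
  shows "\<mu> \<le> l"
proof -
  obtain v where v: "v \<noteq> 0" "W *v v = l *\<^sub>R v" using assms(2) unfolding real_eigenvalues_def by blast
  have "\<mu> * (v \<bullet> v) \<le> l * (v \<bullet> v)" using assms(1)[of v] v(2) by simp
  thus ?thesis using v(1) by simp
qed

lemma real_eigenvalues_uminus: "real_eigenvalues (- W) = uminus ` real_eigenvalues W"
  for W :: "real^'n^'n"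
proof -
  have "- (W *v v) = l *\<^sub>R v \<longleftrightarrow> W *v v = (- l) *\<^sub>R v" for v and l :: real
    by (metis minus_minus scaleR_minus_left)
  hence "l \<in> real_eigenvalues (- W) \<longleftrightarrow> - l \<in> real_eigenvalues W" for l
    unfolding real_eigenvalues_def matrix_vector_mult_uminus_left by simp
  thus ?thesis by (force intro: rev_image_eqI)
qed

lemma
  fixes W :: "real^'n^'n"
  assumes sym: "transpose W = W"
  shows lambda_min_in_real_eigenvalues: "lambda_min W \<in> real_eigenvalues W"
    and lambda_min_le_quadratic_form: "lambda_min W * (x \<bullet> x) \<le> x \<bullet> (W *v x)"
proof -
  obtain \<mu> where \<mu>: "\<mu> \<in> real_eigenvalues W" "\<And>x. \<mu> * (x \<bullet> x) \<le> x \<bullet> (W *v x)"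
    using symmetric_matrix_min_eigenvalue[OF sym] by blast
  have "lambda_min W = \<mu>"
    unfolding lambda_min_def using \<mu> rayleigh_lower_le_eigenvalue finite_real_eigenvalues_symmetric[OF sym]
    by (intro Min_eqI) auto
  thus "lambda_min W \<in> real_eigenvalues W" "lambda_min W * (x \<bullet> x) \<le> x \<bullet> (W *v x)" using \<mu> by auto
qed

lemma lambda_max_eq_uminus_lambda_min:
  fixes W :: "real^'n^'n"
  assumes sym: "transpose W = W"
  shows "lambda_max W = - lambda_min (- W)"
  using minus_Max_eq_Min[OF finite_real_eigenvalues_symmetric[OF sym]]
    lambda_min_in_real_eigenvalues[OF sym]
  unfolding lambda_max_def lambda_min_def real_eigenvalues_uminus by fastforce

lemma quadratic_form_le_lambda_max:
  fixes W :: "real^'n^'n"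
  assumes sym: "transpose W = W"
  shows "x \<bullet> (W *v x) \<le> lambda_max W * (x \<bullet> x)"
proof -
  have "transpose (- W) = - W" using sym by (simp add: transpose_uminus)
  from lambda_min_le_quadratic_form[OF this, of x] show ?thesis
    by (simp add: lambda_max_eq_uminus_lambda_min[OF sym] matrix_vector_mult_uminus_left)
qed

lemma lambda_min_le_lambda_max:
  fixes W :: "real^'n^'n"
  assumes sym: "transpose W = W"
  shows "lambda_min W \<le> lambda_max W"
proof -
  obtain x :: "real^'n" where "norm x = 1" using vector_choose_size[of 1] by auto
  hence "0 < x \<bullet> x" by (simp add: dot_square_norm)
  with lambda_min_le_quadratic_form[OF sym, of x] quadratic_form_le_lambda_max[OF sym, of x]
  show ?thesis by (meson mult_right_le_imp_le order_trans)
qed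

lemma abs_real_eigenvalue_le_onorm:
  fixes W :: "real^'n^'n"
  assumes "l \<in> real_eigenvalues W"
  shows "\<bar>l\<bar> \<le> onorm ((*v) W)"
proof -
  obtain v where v: "v \<noteq> 0" "W *v v = l *\<^sub>R v" using assms unfolding real_eigenvalues_def by blast
  have "\<bar>l\<bar> * norm v \<le> onorm ((*v) W) * norm v"
    using onorm[OF matrix_vector_mul_bounded_linear, of W v] v(2) by simp
  thus ?thesis using v(1) by simp
qed

lemma lambda_min_ge_minus_norm:
  fixes W :: "real^'n^'n"
  assumes "transpose W = W"
  shows "- (real CARD('n) * real CARD('n) * norm W) \<le> lambda_min W"
proof -
  have "onorm ((*v) W) \<le> real CARD('n) * real CARD('n) * norm W"
    by (rule onorm_le_matrix_component) (meson component_le_norm_cart Finite_Cartesian_Product.norm_nth_le order_trans)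
  thus ?thesis using abs_real_eigenvalue_le_onorm[OF lambda_min_in_real_eigenvalues[OF assms]] by linarith
qed

section \<open>Symmetry of the Hessian\<close>

lemma second_difference_mean_value:
  fixes u :: "real^'n \<Rightarrow> real"
  assumes D1: "\<And>y. y \<in> ball x r \<Longrightarrow> (u has_derivative (\<lambda>v. Du y \<bullet> v)) (at y)"
    and hk: "norm h + norm k < r"
  obtains \<xi> where "0 < \<xi>" "\<xi> < 1"
    "u (x + h + k) - u (x + h) - u (x + k) + u x = (Du (x + h + \<xi> *\<^sub>R k) - Du (x + \<xi> *\<^sub>R k)) \<bullet> k"
proof -
  define g where "g t = u (x + h + t *\<^sub>R k) - u (x + t *\<^sub>R k)" for t
  define g' where "g' t = (\<lambda>s. (Du (x + h + t *\<^sub>R k) - Du (x + t *\<^sub>R k)) \<bullet> (s *\<^sub>R k))" for t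
  have "(g has_derivative g' t) (at t within {0..1})" if t: "0 \<le> t" "t \<le> 1" for t
  proof -
    have "norm (t *\<^sub>R k) \<le> norm k" using t by (simp add: mult_left_le_one_le)
    hence "norm (h + t *\<^sub>R k) < r" "norm (t *\<^sub>R k) < r"
      using hk norm_triangle_ineq[of h "t *\<^sub>R k"] norm_ge_zero[of h] by linarith+
    moreover have "dist x (x + v) = norm v" for v by (simp add: dist_norm)
    ultimately have "x + h + t *\<^sub>R k \<in> ball x r" "x + t *\<^sub>R k \<in> ball x r"
      by (simp_all only: mem_ball add.assoc)
    hence "(g has_derivative g' t) (at t)"
      unfolding g_def g'_def inner_diff_left
      by (intro has_derivative_diff has_derivative_compose[OF _ D1] derivative_eq_intros) auto
    thus ?thesis by (rule has_derivative_at_withinI)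
  qed
  then obtain \<xi> where "\<xi> \<in> {0<..<1}" and mv: "g 1 - g 0 = g' \<xi> 1"
    using mvt_simple[of 0 1 g g'] by auto
  thus thesis by (intro that[of \<xi>]) (use mv in \<open>auto simp: g_def g'_def\<close>)
qed

lemma second_difference_hessian_estimate:
  fixes u :: "real^'n \<Rightarrow> real"
  assumes D1: "\<And>y. y \<in> ball x r \<Longrightarrow> (u has_derivative (\<lambda>v. Du y \<bullet> v)) (at y)"
    and est: "\<And>y. norm (y - x) < d \<Longrightarrow> norm (Du y - Du x - D2 *v (y - x)) \<le> e * norm (y - x)"
    and hk: "norm h + norm k < r" "norm h + norm k < d" and e: "0 \<le> e"
  shows "\<bar>u (x + h + k) - u (x + h) - u (x + k) + u x - (D2 *v h) \<bullet> k\<bar>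
          \<le> e * norm k * (norm h + 2 * norm k)"
proof -
  obtain \<xi> where \<xi>: "0 < \<xi>" "\<xi> < 1"
    and mv: "u (x + h + k) - u (x + h) - u (x + k) + u x = (Du (x + h + \<xi> *\<^sub>R k) - Du (x + \<xi> *\<^sub>R k)) \<bullet> k"
    using second_difference_mean_value[OF D1 hk(1)] by blast
  define a where "a = x + h + \<xi> *\<^sub>R k"
  define b where "b = x + \<xi> *\<^sub>R k"
  define ra where "ra = Du a - Du x - D2 *v (a - x)"
  define rb where "rb = Du b - Du x - D2 *v (b - x)"
  have nk: "norm (\<xi> *\<^sub>R k) \<le> norm k" using \<xi> by (simp add: mult_left_le_one_le)
  hence na: "norm (a - x) \<le> norm h + norm k"
    using norm_triangle_ineq[of h "\<xi> *\<^sub>R k"] by (simp add: a_def add.assoc)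
  have nb: "norm (b - x) \<le> norm k" using nk by (simp add: b_def)
  have "norm ra \<le> e * norm (a - x)" unfolding ra_def using na hk(2) by (intro est) linarith
  also have "\<dots> \<le> e * (norm h + norm k)" using na e by (rule mult_left_mono)
  finally have "norm ra \<le> e * (norm h + norm k)" .
  moreover have "norm rb \<le> e * norm (b - x)"
    unfolding rb_def using nb hk(2) norm_ge_zero[of h] by (intro est) linarith
  with nb e have "norm rb \<le> e * norm k" by (meson mult_left_mono order_trans)
  ultimately have "norm (ra - rb) \<le> e * (norm h + 2 * norm k)"
    using norm_triangle_ineq4[of ra rb] by (simp add: algebra_simps)
  hence "\<bar>(ra - rb) \<bullet> k\<bar> \<le> e * (norm h + 2 * norm k) * norm k"
    by (meson Cauchy_Schwarz_ineq2 mult_right_mono norm_ge_zero order_trans)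
  moreover have "(Du a - Du b) \<bullet> k - (D2 *v h) \<bullet> k = (ra - rb) \<bullet> k"
    by (simp add: ra_def rb_def a_def b_def matrix_vector_mult_diff_distrib inner_diff_left algebra_simps)
  ultimately show ?thesis by (simp add: mv[folded a_def b_def] mult.commute mult.left_commute)
qed

lemma hessian_inner_swap_estimate:
  fixes u :: "real^'n \<Rightarrow> real"
  assumes r: "0 < r" and D1: "\<And>y. y \<in> ball x r \<Longrightarrow> (u has_derivative (\<lambda>v. Du y \<bullet> v)) (at y)"
    and D2: "(Du has_derivative (\<lambda>v. D2 *v v)) (at x)" and e: "0 < e"
  shows "\<bar>(D2 *v h) \<bullet> k - (D2 *v k) \<bullet> h\<bar>
           \<le> e * (norm k * (norm h + 2 * norm k) + norm h * (norm k + 2 * norm h))"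
proof -
  obtain d where d: "0 < d"
    "\<And>y. norm (y - x) < d \<Longrightarrow> norm (Du y - Du x - D2 *v (y - x)) \<le> e * norm (y - x)"
    using D2 e unfolding has_derivative_at_alt by blast
  define N where "N = norm h + norm k"
  define s where "s = min r d / (N + 1)"
  have N: "0 \<le> N" by (simp add: N_def)
  hence s: "0 < s" using r d by (simp add: s_def)
  have "s * N = min r d * (N / (N + 1))" by (simp add: s_def)
  also have "\<dots> < min r d * 1" using r d N by (intro mult_strict_left_mono) auto
  finally have "s * (norm h + norm k) < min r d" by (simp add: N_def)
  hence hk: "norm (s *\<^sub>R h) + norm (s *\<^sub>R k) < r" "norm (s *\<^sub>R h) + norm (s *\<^sub>R k) < d"
    using s by (simp_all add: algebra_simps)
  have kh: "norm (s *\<^sub>R k) + norm (s *\<^sub>R h) < r" "norm (s *\<^sub>R k) + norm (s *\<^sub>R h) < d"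
    using hk by simp_all
  note est_hk = second_difference_hessian_estimate[OF D1 d(2) hk less_imp_le[OF e]]
  note est_kh = second_difference_hessian_estimate[OF D1 d(2) kh less_imp_le[OF e]]
  have "u (x + s *\<^sub>R k + s *\<^sub>R h) = u (x + s *\<^sub>R h + s *\<^sub>R k)" by (simp add: algebra_simps)
  hence "\<bar>(D2 *v (s *\<^sub>R h)) \<bullet> (s *\<^sub>R k) - (D2 *v (s *\<^sub>R k)) \<bullet> (s *\<^sub>R h)\<bar>
      \<le> e * norm (s *\<^sub>R k) * (norm (s *\<^sub>R h) + 2 * norm (s *\<^sub>R k))
        + e * norm (s *\<^sub>R h) * (norm (s *\<^sub>R k) + 2 * norm (s *\<^sub>R h))"
    using est_hk est_kh by linarith
  also have "\<dots> = s\<^sup>2 * (e * (norm k * (norm h + 2 * norm k) + norm h * (norm k + 2 * norm h)))"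
    using s by (simp add: power2_eq_square algebra_simps)
  finally show ?thesis using s
    by (simp add: matrix_vector_mult_scaleR power2_eq_square abs_mult right_diff_distrib[symmetric])
qed

lemma hessian_inner_symmetric:
  fixes u :: "real^'n \<Rightarrow> real"
  assumes "open \<Omega>" "x \<in> \<Omega>"
    and D1: "\<And>y. y \<in> \<Omega> \<Longrightarrow> (u has_derivative (\<lambda>v. Du y \<bullet> v)) (at y)"
    and D2: "(Du has_derivative (\<lambda>v. D2 *v v)) (at x)"
  shows "(D2 *v h) \<bullet> k = (D2 *v k) \<bullet> h"
proof -
  obtain r where r: "0 < r" "ball x r \<subseteq> \<Omega>" using assms(1,2) open_contains_ball by blast
  define C where "C = norm k * (norm h + 2 * norm k) + norm h * (norm k + 2 * norm h)"
  have C: "0 \<le> C" by (simp add: C_def)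
  have D1': "\<And>y. y \<in> ball x r \<Longrightarrow> (u has_derivative (\<lambda>v. Du y \<bullet> v)) (at y)" using D1 r(2) by blast
  have bound: "\<bar>(D2 *v h) \<bullet> k - (D2 *v k) \<bullet> h\<bar> \<le> e * C" if "0 < e" for e
    unfolding C_def by (rule hessian_inner_swap_estimate[OF r(1) D1' D2 that])
  have "\<bar>(D2 *v h) \<bullet> k - (D2 *v k) \<bullet> h\<bar> \<le> 0"
  proof (rule field_le_epsilon)
    fix e :: real assume e: "0 < e"
    have "\<bar>(D2 *v h) \<bullet> k - (D2 *v k) \<bullet> h\<bar> \<le> e / (C + 1) * C"
      using bound[of "e / (C + 1)"] e C by simp
    also have "\<dots> \<le> e" using e C by (simp add: field_simps)
    finally show "\<bar>(D2 *v h) \<bullet> k - (D2 *v k) \<bullet> h\<bar> \<le> 0 + e" by simp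
  qed
  thus ?thesis by simp
qed

lemma hessian_symmetric_on_closure:
  fixes u :: "real^'n \<Rightarrow> real"
  assumes "open \<Omega>"
    and D1: "\<And>y. y \<in> \<Omega> \<Longrightarrow> (u has_derivative (\<lambda>v. Du y \<bullet> v)) (at y)"
    and D2: "\<And>y. y \<in> \<Omega> \<Longrightarrow> (Du has_derivative (\<lambda>v. D2u y *v v)) (at y)"
    and cont: "continuous_on (closure \<Omega>) D2u"
    and x: "x \<in> closure \<Omega>"
  shows "transpose (D2u x) = D2u x"
proof -
  have "D2u x $ i $ j - D2u x $ j $ i = 0" for i j
  proof (rule continuous_constant_on_closure[OF _ _ x])
    show "continuous_on (closure \<Omega>) (\<lambda>x. D2u x $ i $ j - D2u x $ j $ i)"
      by (intro continuous_intros continuous_on_component cont)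
    fix y assume y: "y \<in> \<Omega>"
    show "D2u y $ i $ j - D2u y $ j $ i = 0"
      using hessian_inner_symmetric[OF assms(1) y D1 D2[OF y], of "axis j 1" "axis i 1"]
      by (simp add: matrix_vector_mult_basis inner_axis column_def)
  qed
  thus ?thesis by (simp add: transpose_def Finite_Cartesian_Product.vec_eq_iff)
qed

section \<open>Principal minors as products of Rayleigh values\<close>

definition supported_on :: "'n set \<Rightarrow> real^'n \<Rightarrow> bool" where
  "supported_on I x \<longleftrightarrow> (\<forall>i. i \<notin> I \<longrightarrow> x $ i = 0)"

text \<open>Here e enumerates I as e 0, ..., e (k - 1); the entries are taken complex so that the
  characteristic polynomial splits.\<close>

definition principal_submatrix :: "real^'n^'n \<Rightarrow> (nat \<Rightarrow> 'n) \<Rightarrow> nat \<Rightarrow> complex Matrix.mat" where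
  "principal_submatrix R e k = Matrix.mat k k (\<lambda>(i, j). complex_of_real (R $ e i $ e j))"

lemma principal_submatrix_carrier: "principal_submatrix R e k \<in> carrier_mat k k"
  by (simp add: principal_submatrix_def)

lemma bij_betw_map_permutation:
  fixes k :: nat
  assumes e: "bij_betw e {0..<k} I"
  shows "bij_betw (map_permutation {0..<k} e) {p. p permutes {0..<k}} {q. q permutes I}"
proof (rule bij_betw_byWitness[where f' = "map_permutation I (inv_into {0..<k} e)"])
  have ie: "bij_betw (inv_into {0..<k} e) I {0..<k}" by (rule bij_betw_inv_into[OF e])
  show "\<forall>p\<in>{p. p permutes {0..<k}}. map_permutation I (inv_into {0..<k} e) (map_permutation {0..<k} e p) = p"
    using e by (auto intro!: map_permutation_compose_inv simp: bij_betw_inv_into_left)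
  show "\<forall>q\<in>{q. q permutes I}. map_permutation {0..<k} e (map_permutation I (inv_into {0..<k} e) q) = q"
    using ie e by (auto intro!: map_permutation_compose_inv simp: bij_betw_inv_into_right)
  show "map_permutation {0..<k} e ` {p. p permutes {0..<k}} \<subseteq> {q. q permutes I}"
    using e by (auto intro!: map_permutation_permutes)
  show "map_permutation I (inv_into {0..<k} e) ` {q. q permutes I} \<subseteq> {p. p permutes {0..<k}}"
    using ie by (auto intro!: map_permutation_permutes)
qed

lemma det_principal_submatrix:
  fixes R :: "real^'n^'n"
  assumes e: "bij_betw e {0..<k} I"
  shows "Determinant.det (principal_submatrix R e k) = complex_of_real (principal_minor R I)"
proof -
  have inj: "inj_on e {0..<k}" using e by (simp add: bij_betw_def)
  have "principal_minor R I = (\<Sum>p | p permutes {0..<k}. of_int (sign (map_permutation {0..<k} e p)) *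
       (\<Prod>i\<in>I. R $ i $ map_permutation {0..<k} e p i))"
    unfolding principal_minor_def by (rule sum.reindex_bij_betw[OF bij_betw_map_permutation[OF e], symmetric])
  also have "\<dots> = (\<Sum>p | p permutes {0..<k}. of_int (sign p) * (\<Prod>j=0..<k. R $ e j $ e (p j)))"
  proof (rule sum.cong[OF refl])
    fix p assume p: "p \<in> {p. p permutes {0..<k}}"
    have "(\<Prod>i\<in>I. R $ i $ map_permutation {0..<k} e p i)
        = (\<Prod>j=0..<k. R $ e j $ map_permutation {0..<k} e p (e j))"
      by (rule prod.reindex_bij_betw[OF e, symmetric])
    also have "\<dots> = (\<Prod>j=0..<k. R $ e j $ e (p j))"
      by (rule prod.cong[OF refl]) (simp add: map_permutation_apply[OF inj])
    moreover have "sign (map_permutation {0..<k} e p) = sign p"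
      using p inj by (intro sign_map_permutation) auto
    ultimately show "of_int (sign (map_permutation {0..<k} e p)) * (\<Prod>i\<in>I. R $ i $ map_permutation {0..<k} e p i)
       = of_int (sign p) * (\<Prod>j=0..<k. R $ e j $ e (p j))" by simp
  qed
  finally have pm: "principal_minor R I = \<dots>" .
  have "Determinant.det (principal_submatrix R e k)
      = (\<Sum>p | p permutes {0..<k}. signof p * (\<Prod>i=0..<k. principal_submatrix R e k $$ (i, p i)))"
    by (rule det_def'[OF principal_submatrix_carrier])
  also have "\<dots> = (\<Sum>p | p permutes {0..<k}. complex_of_real (of_int (sign p) * (\<Prod>j=0..<k. R $ e j $ e (p j))))"
  proof (rule sum.cong[OF refl])
    fix p assume "p \<in> {p. p permutes {0..<k}}"
    hence "(\<Prod>i=0..<k. principal_submatrix R e k $$ (i, p i)) = (\<Prod>i=0..<k. complex_of_real (R $ e i $ e (p i)))"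
      by (intro prod.cong refl) (auto simp: principal_submatrix_def dest: permutes_in_image)
    thus "signof p * (\<Prod>i=0..<k. principal_submatrix R e k $$ (i, p i))
        = complex_of_real (of_int (sign p) * (\<Prod>j=0..<k. R $ e j $ e (p j)))" by simp
  qed
  also have "\<dots> = complex_of_real (principal_minor R I)" unfolding pm by simp
  finally show ?thesis .
qed

lemma poly_char_poly_principal_submatrix:
  fixes R :: "real^'n^'n"
  assumes e: "bij_betw e {0..<k} I"
  shows "poly (char_poly (principal_submatrix R e k)) (complex_of_real t) =
         complex_of_real (principal_minor (Finite_Cartesian_Product.mat t - R) I)"
proof -
  have inj: "inj_on e {0..<k}" using e by (simp add: bij_betw_def)
  have "- char_matrix (principal_submatrix R e k) (complex_of_real t)
      = principal_submatrix (Finite_Cartesian_Product.mat t - R) e k"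
  proof (rule eq_matI)
    fix i j assume "i < dim_row (principal_submatrix (Finite_Cartesian_Product.mat t - R) e k)"
      and "j < dim_col (principal_submatrix (Finite_Cartesian_Product.mat t - R) e k)"
    hence ij: "i < k" "j < k" by (auto simp: principal_submatrix_def)
    hence "e i = e j \<longleftrightarrow> i = j" using inj by (auto simp: inj_on_def)
    thus "(- char_matrix (principal_submatrix R e k) (complex_of_real t)) $$ (i, j)
        = principal_submatrix (Finite_Cartesian_Product.mat t - R) e k $$ (i, j)"
      using ij by (simp add: char_matrix_def principal_submatrix_def Finite_Cartesian_Product.mat_def)
  qed (auto simp: char_matrix_def principal_submatrix_def)
  thus ?thesis
    using det_principal_submatrix[OF e, of "Finite_Cartesian_Product.mat t - R"]
    unfolding char_poly_matrix[OF principal_submatrix_carrier] by simp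
qed

definition zero_extension :: "(nat \<Rightarrow> 'n) \<Rightarrow> nat \<Rightarrow> (nat \<Rightarrow> real) \<Rightarrow> real^'n" where
  "zero_extension e k xv = (\<chi> i. if i \<in> e ` {0..<k} then xv (inv_into {0..<k} e i) else 0)"

lemma zero_extension_nth:
  assumes "bij_betw e {0..<k} I" "j < k"
  shows "zero_extension e k xv $ e j = xv j"
proof -
  have "inj_on e {0..<k}" using assms(1) by (simp add: bij_betw_def)
  thus ?thesis using assms(2) by (simp add: zero_extension_def inv_into_f_f)
qed

lemma supported_on_zero_extension:
  "bij_betw e {0..<k} I \<Longrightarrow> supported_on I (zero_extension e k xv)"
  by (auto simp: supported_on_def zero_extension_def bij_betw_def)

lemma sum_UNIV_supported:
  fixes f :: "'n::finite \<Rightarrow> real" and k :: nat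
  assumes e: "bij_betw e {0..<k} I" and z: "\<And>i. i \<notin> I \<Longrightarrow> f i = 0"
  shows "(\<Sum>i\<in>UNIV. f i) = (\<Sum>j<k. f (e j))"
proof -
  have "(\<Sum>i\<in>UNIV. f i) = (\<Sum>i\<in>I. f i)" by (rule sum.mono_neutral_right) (auto simp: z)
  also have "\<dots> = (\<Sum>j<k. f (e j))" using sum.reindex_bij_betw[OF e, of f] by (simp add: atLeast0LessThan)
  finally show ?thesis .
qed

lemma inner_zero_extension_matrix:
  fixes R :: "real^'n^'n"
  assumes e: "bij_betw e {0..<k} I"
  shows "zero_extension e k xv \<bullet> (R *v zero_extension e k yv) = (\<Sum>j<k. \<Sum>l<k. xv j * R $ e j $ e l * yv l)"
proof -
  note ext = zero_extension_nth[OF e] supported_on_zero_extension[OF e, unfolded supported_on_def]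
  have "(R *v zero_extension e k yv) $ i = (\<Sum>l<k. R $ i $ e l * yv l)" for i
    unfolding matrix_vector_mult_def by (simp add: sum_UNIV_supported[OF e] ext)
  thus ?thesis
    by (simp add: inner_vec_def sum_UNIV_supported[OF e] ext sum_distrib_left mult.assoc)
qed

lemma inner_zero_extension_self:
  "bij_betw e {0..<k} I \<Longrightarrow> zero_extension e k xv \<bullet> zero_extension e k xv = (\<Sum>j<k. (xv j)\<^sup>2)"
  by (simp add: inner_vec_def sum_UNIV_supported zero_extension_nth power2_eq_square
      supported_on_zero_extension[unfolded supported_on_def])

text \<open>b is the value z* N z / z* z of the Hermitian form of N at a nonzero complex vector
  z = X + i Y supported on I.\<close>

definition rayleigh_value_on :: "real^'n^'n \<Rightarrow> 'n set \<Rightarrow> complex \<Rightarrow> bool" where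
  "rayleigh_value_on N I b \<longleftrightarrow> (\<exists>X Y. supported_on I X \<and> supported_on I Y \<and> 0 < X \<bullet> X + Y \<bullet> Y \<and>
     Re b * (X \<bullet> X + Y \<bullet> Y) = X \<bullet> (N *v X) + Y \<bullet> (N *v Y) \<and>
     Im b * (X \<bullet> X + Y \<bullet> Y) = X \<bullet> (N *v Y) - Y \<bullet> (N *v X))"

lemma eigenvalue_principal_submatrix_rayleigh_value:
  fixes R :: "real^'n^'n"
  assumes e: "bij_betw e {0..<k} I"
    and a: "eigenvalue (principal_submatrix R e k) a"
  shows "rayleigh_value_on R I a"
proof -
  obtain v where "eigenvector (principal_submatrix R e k) v a" using a unfolding eigenvalue_def by blast
  hence v: "v \<in> carrier_vec k" "v \<noteq> 0\<^sub>v k" "principal_submatrix R e k *\<^sub>v v = a \<cdot>\<^sub>v v"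
    unfolding eigenvector_def by (auto simp: principal_submatrix_def)
  define X where "X = zero_extension e k (\<lambda>j. Re (v $ j))"
  define Y where "Y = zero_extension e k (\<lambda>j. Im (v $ j))"
  have XY: "X \<bullet> X + Y \<bullet> Y = (\<Sum>j<k. cmod (v $ j) ^ 2)"
    by (simp add: X_def Y_def inner_zero_extension_self[OF e] sum.distrib[symmetric] cmod_power2)
  have row: "(\<Sum>l<k. complex_of_real (R $ e j $ e l) * v $ l) = a * v $ j" if "j < k" for j
  proof -
    have "(principal_submatrix R e k *\<^sub>v v) $ j = a * v $ j" using v that by simp
    thus ?thesis
      using that v(1) by (simp add: principal_submatrix_def scalar_prod_def lessThan_atLeast0)
  qed
  \<comment> \<open>The Hermitian form v* R_I v, evaluated once via the eigenvalue equation and once by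
    splitting v into real and imaginary parts.\<close>
  define S where "S = (\<Sum>j<k. cnj (v $ j) * (\<Sum>l<k. complex_of_real (R $ e j $ e l) * v $ l))"
  have "S = (\<Sum>j<k. cnj (v $ j) * (a * v $ j))" unfolding S_def by (rule sum.cong) (simp_all add: row)
  also have "\<dots> = a * (\<Sum>j<k. cnj (v $ j) * v $ j)" by (simp add: sum_distrib_left ac_simps)
  also have "(\<Sum>j<k. cnj (v $ j) * v $ j) = complex_of_real (X \<bullet> X + Y \<bullet> Y)"
    unfolding XY of_real_sum by (intro sum.cong refl) (metis complex_norm_square mult.commute)
  finally have S: "S = a * complex_of_real (X \<bullet> X + Y \<bullet> Y)" .
  have "Re S = (\<Sum>j<k. \<Sum>l<k. Re (v $ j) * R $ e j $ e l * Re (v $ l) + Im (v $ j) * R $ e j $ e l * Im (v $ l))"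
    unfolding S_def sum_distrib_left by (simp add: Re_sum algebra_simps)
  hence "Re S = X \<bullet> (R *v X) + Y \<bullet> (R *v Y)"
    by (simp add: X_def Y_def inner_zero_extension_matrix[OF e] sum.distrib)
  moreover have "Im S = (\<Sum>j<k. \<Sum>l<k. Re (v $ j) * R $ e j $ e l * Im (v $ l) - Im (v $ j) * R $ e j $ e l * Re (v $ l))"
    unfolding S_def sum_distrib_left by (simp add: Im_sum algebra_simps)
  hence "Im S = X \<bullet> (R *v Y) - Y \<bullet> (R *v X)"
    by (simp add: X_def Y_def inner_zero_extension_matrix[OF e] sum_subtractf)
  moreover have "0 < X \<bullet> X + Y \<bullet> Y"
  proof -
    obtain j where j: "j < k" "v $ j \<noteq> 0"
      using v(1,2) by (metis carrier_vecD eq_vecI index_zero_vec(1) index_zero_vec(2))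
    hence "0 < cmod (v $ j) ^ 2" by simp
    also have "\<dots> \<le> (\<Sum>j<k. cmod (v $ j) ^ 2)" using j(1) by (intro member_le_sum) auto
    finally show ?thesis unfolding XY .
  qed
  moreover have "supported_on I X" "supported_on I Y"
    by (simp_all add: X_def Y_def supported_on_zero_extension[OF e])
  ultimately show ?thesis unfolding rayleigh_value_on_def using S by auto
qed

lemma matrix_vector_mult_mat: "Finite_Cartesian_Product.mat t *v x = t *\<^sub>R (x :: real^'n)"
proof -
  have "(\<Sum>j\<in>UNIV. Finite_Cartesian_Product.mat t $ i $ j * x $ j) = (\<Sum>j\<in>UNIV. if j = i then t * x $ j else 0)"
    for i by (rule sum.cong) (auto simp: Finite_Cartesian_Product.mat_def)
  thus ?thesis by (simp add: matrix_vector_mult_def Finite_Cartesian_Product.vec_eq_iff)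
qed

lemma principal_minor_uminus: "principal_minor (- R) I = (-1) ^ card I * principal_minor R I"
  for R :: "real^'n^'n"
  unfolding principal_minor_def sum_distrib_left by (rule sum.cong[OF refl]) (simp add: prod_uminus)

lemma continuous_on_principal_minor_affine:
  "continuous_on T (\<lambda>t. principal_minor (A + t *\<^sub>R D) I)" for A D :: "real^'n^'n"
  unfolding principal_minor_def by (intro continuous_intros)

text \<open>The b are the complex eigenvalues of the principal submatrix of N on I.\<close>

lemma principal_minor_factorization:
  fixes N :: "real^'n^'n"
  shows "\<exists>bs. length bs = card I \<and>
    (\<forall>t. complex_of_real (principal_minor (N - Finite_Cartesian_Product.mat t) I)
          = (\<Prod>b\<leftarrow>bs. b - complex_of_real t)) \<and>
    (\<forall>b\<in>set bs. rayleigh_value_on N I b)"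
proof -
  obtain e where e: "bij_betw e {0..<card I} I" using ex_bij_betw_nat_finite[of I] by auto
  obtain bs where bs: "char_poly (principal_submatrix N e (card I)) = (\<Prod>b\<leftarrow>bs. [:- b, 1:])"
      "length bs = card I"
    using char_poly_factorized[OF principal_submatrix_carrier] by blast
  have poly_bs: "poly (char_poly (principal_submatrix N e (card I))) x = (\<Prod>b\<leftarrow>bs. x - b)" for x
    unfolding bs(1) by (induct bs) (simp_all add: algebra_simps)
  have sign: "(\<Prod>b\<leftarrow>cs. x - b) = (-1) ^ length cs * (\<Prod>b\<leftarrow>cs. b - x)" for cs and x :: complex
    by (induct cs) (simp_all add: algebra_simps)
  have "complex_of_real (principal_minor (N - Finite_Cartesian_Product.mat t) I)
      = (\<Prod>b\<leftarrow>bs. b - complex_of_real t)" for t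
  proof -
    have "principal_minor (Finite_Cartesian_Product.mat t - N) I
        = (-1) ^ card I * principal_minor (N - Finite_Cartesian_Product.mat t) I"
      using principal_minor_uminus[of "N - Finite_Cartesian_Product.mat t" I] by simp
    hence "(-1) ^ card I * complex_of_real (principal_minor (N - Finite_Cartesian_Product.mat t) I)
        = (\<Prod>b\<leftarrow>bs. complex_of_real t - b)"
      using poly_char_poly_principal_submatrix[OF e, of N t] by (simp add: poly_bs)
    thus ?thesis by (simp add: sign bs(2))
  qed
  moreover have "rayleigh_value_on N I b" if "b \<in> set bs" for b
  proof (rule eigenvalue_principal_submatrix_rayleigh_value[OF e])
    have "poly (char_poly (principal_submatrix N e (card I))) b = 0"
      using that unfolding poly_bs by (induct bs) auto
    thus "eigenvalue (principal_submatrix N e (card I)) b"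
      using eigenvalue_root_char_poly[OF principal_submatrix_carrier] by blast
  qed
  ultimately show ?thesis using bs(2) by blast
qed

lemma rayleigh_value_on_Re_ge:
  fixes N :: "real^'n^'n"
  assumes "rayleigh_value_on N I b"
    and "\<And>x. supported_on I x \<Longrightarrow> c * (x \<bullet> x) \<le> x \<bullet> (N *v x)"
  shows "c \<le> Re b"
proof -
  obtain X Y :: "real^'n" where XY: "supported_on I X" "supported_on I Y" "0 < X \<bullet> X + Y \<bullet> Y"
    "Re b * (X \<bullet> X + Y \<bullet> Y) = X \<bullet> (N *v X) + Y \<bullet> (N *v Y)"
    using assms(1) unfolding rayleigh_value_on_def by blast
  have "c * (X \<bullet> X + Y \<bullet> Y) \<le> Re b * (X \<bullet> X + Y \<bullet> Y)"
    using assms(2)[OF XY(1)] assms(2)[OF XY(2)] XY(4) by (simp add: distrib_left)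
  thus ?thesis using XY(3) by (rule mult_right_le_imp_le)
qed

lemma rayleigh_value_on_Re_le:
  fixes N :: "real^'n^'n"
  assumes "rayleigh_value_on N I b"
    and "\<And>x. supported_on I x \<Longrightarrow> x \<bullet> (N *v x) \<le> C * (x \<bullet> x)"
  shows "Re b \<le> C"
proof -
  obtain X Y :: "real^'n" where XY: "supported_on I X" "supported_on I Y" "0 < X \<bullet> X + Y \<bullet> Y"
    "Re b * (X \<bullet> X + Y \<bullet> Y) = X \<bullet> (N *v X) + Y \<bullet> (N *v Y)"
    using assms(1) unfolding rayleigh_value_on_def by blast
  have "Re b * (X \<bullet> X + Y \<bullet> Y) \<le> C * (X \<bullet> X + Y \<bullet> Y)"
    using assms(2)[OF XY(1)] assms(2)[OF XY(2)] XY(4) by (simp add: distrib_left)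
  thus ?thesis using XY(3) by (rule mult_right_le_imp_le)
qed

lemma rayleigh_value_on_abs_Im_le:
  fixes N :: "real^'n^'n"
  assumes "rayleigh_value_on N I b" and "0 \<le> \<beta>"
    and "\<And>x y. supported_on I x \<Longrightarrow> supported_on I y \<Longrightarrow>
           \<bar>x \<bullet> (N *v y) - y \<bullet> (N *v x)\<bar> \<le> 2 * \<beta> * norm x * norm y"
  shows "\<bar>Im b\<bar> \<le> \<beta>"
proof -
  obtain X Y :: "real^'n" where XY: "supported_on I X" "supported_on I Y" "0 < X \<bullet> X + Y \<bullet> Y"
    "Im b * (X \<bullet> X + Y \<bullet> Y) = X \<bullet> (N *v Y) - Y \<bullet> (N *v X)"
    using assms(1) unfolding rayleigh_value_on_def by blast
  have "\<bar>Im b\<bar> * (X \<bullet> X + Y \<bullet> Y) = \<bar>X \<bullet> (N *v Y) - Y \<bullet> (N *v X)\<bar>"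
    using XY(3,4) by (metis abs_mult abs_of_pos)
  also have "\<dots> \<le> \<beta> * (2 * (norm X * norm Y))" using assms(3)[OF XY(1,2)] by (simp add: ac_simps)
  also have "\<dots> \<le> \<beta> * (X \<bullet> X + Y \<bullet> Y)"
    using assms(2) sum_squares_bound[of "norm X" "norm Y"]
    by (intro mult_left_mono) (simp_all add: power2_norm_eq_inner)
  finally show ?thesis using XY(3) by (rule mult_right_le_imp_le)
qed

lemma rayleigh_value_on_symmetric_Im:
  fixes N :: "real^'n^'n"
  assumes "rayleigh_value_on N I b" and "transpose N = N"
  shows "Im b = 0"
proof -
  obtain X Y :: "real^'n" where XY: "0 < X \<bullet> X + Y \<bullet> Y"
    "Im b * (X \<bullet> X + Y \<bullet> Y) = X \<bullet> (N *v Y) - Y \<bullet> (N *v X)"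
    using assms(1) unfolding rayleigh_value_on_def by blast
  thus ?thesis using inner_symmetric_matrix_vector[OF assms(2), of X Y] by simp
qed

section \<open>Bounds for principal minors\<close>

lemma norm_prod_list_ge_power:
  fixes bs :: "'a::real_normed_div_algebra list"
  shows "(\<And>b. b \<in> set bs \<Longrightarrow> c \<le> norm b) \<Longrightarrow> 0 \<le> c \<Longrightarrow> c ^ length bs \<le> norm (prod_list bs)"
  by (induct bs) (auto simp: norm_mult intro!: mult_mono)

lemma norm_prod_list_le_power:
  fixes bs :: "'a::real_normed_div_algebra list"
  shows "(\<And>b. b \<in> set bs \<Longrightarrow> norm b \<le> K) \<Longrightarrow> norm (prod_list bs) \<le> K ^ length bs"
proof (induct bs)
  case (Cons a bs)
  hence "0 \<le> K" by (meson list.set_intros(1) norm_ge_zero order_trans)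
  thus ?case using Cons by (auto simp: norm_mult intro!: mult_mono)
qed simp

lemma norm_prod_list_le_power_member:
  fixes bs :: "'a::real_normed_div_algebra list"
  assumes "\<And>b. b \<in> set bs \<Longrightarrow> norm b \<le> K" "b0 \<in> set bs" "norm b0 \<le> C" "0 \<le> C"
  shows "norm (prod_list bs) \<le> C * K ^ (length bs - 1)"
  using assms
proof (induct bs)
  case (Cons a bs)
  have K: "0 \<le> K" using Cons(2) by (meson list.set_intros(1) norm_ge_zero order_trans)
  have "norm (prod_list (a # bs)) = norm a * norm (prod_list bs)" by (simp add: norm_mult)
  also have "\<dots> \<le> C * K ^ (length (a # bs) - 1)"
  proof (cases "a = b0")
    case True
    have "norm (prod_list bs) \<le> K ^ length bs" by (rule norm_prod_list_le_power) (use Cons(2) in auto)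
    thus ?thesis using True Cons(4,5) by (auto intro: mult_mono)
  next
    case False
    hence b0: "b0 \<in> set bs" using Cons(3) by simp
    have "norm a * norm (prod_list bs) \<le> K * (C * K ^ (length bs - 1))"
      using Cons b0 K by (intro mult_mono) auto
    also have "\<dots> = C * K ^ (length (a # bs) - 1)" using b0 by (cases bs) (auto simp: algebra_simps)
    finally show ?thesis .
  qed
  finally show ?case .
qed simp

lemma prod_list_real_pos:
  "(\<And>b. b \<in> set bs \<Longrightarrow> Im b = 0 \<and> 0 < Re b) \<Longrightarrow> Im (prod_list bs) = 0 \<and> 0 < Re (prod_list bs)"
  by (induct bs) auto

lemma abs_principal_minor_ge_power:
  fixes N :: "real^'n^'n"
  assumes c: "0 < c" and low: "\<And>x. supported_on I x \<Longrightarrow> c * (x \<bullet> x) \<le> x \<bullet> (N *v x)"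
  shows "c ^ card I \<le> \<bar>principal_minor N I\<bar>"
proof -
  obtain bs where bs: "length bs = card I"
    "\<And>t. complex_of_real (principal_minor (N - Finite_Cartesian_Product.mat t) I)
          = (\<Prod>b\<leftarrow>bs. b - complex_of_real t)"
    "\<And>b. b \<in> set bs \<Longrightarrow> rayleigh_value_on N I b"
    using principal_minor_factorization[where N=N and I=I] by blast
  have "c \<le> norm b" if "b \<in> set bs" for b
    using rayleigh_value_on_Re_ge[OF bs(3)[OF that] low] complex_Re_le_cmod[of b] by linarith
  hence "c ^ length bs \<le> norm (prod_list bs)" using c by (intro norm_prod_list_ge_power) auto
  moreover have "prod_list bs = complex_of_real (principal_minor N I)" using bs(2)[of 0] by simp
  ultimately show ?thesis using bs(1) by simp
qed

lemma principal_minor_pos_symmetric: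
  fixes N :: "real^'n^'n"
  assumes sym: "transpose N = N" and c: "0 < c"
    and low: "\<And>x. supported_on I x \<Longrightarrow> c * (x \<bullet> x) \<le> x \<bullet> (N *v x)"
  shows "0 < principal_minor N I"
proof -
  obtain bs where bs:
    "\<And>t. complex_of_real (principal_minor (N - Finite_Cartesian_Product.mat t) I)
          = (\<Prod>b\<leftarrow>bs. b - complex_of_real t)"
    "\<And>b. b \<in> set bs \<Longrightarrow> rayleigh_value_on N I b"
    using principal_minor_factorization[where N=N and I=I] by blast
  have "Im b = 0 \<and> 0 < Re b" if "b \<in> set bs" for b
    using rayleigh_value_on_Re_ge[OF bs(2)[OF that] low] rayleigh_value_on_symmetric_Im[OF bs(2)[OF that] sym] c
    by simp
  hence "Im (prod_list bs) = 0 \<and> 0 < Re (prod_list bs)" by (rule prod_list_real_pos)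
  moreover have "prod_list bs = complex_of_real (principal_minor N I)" using bs(1)[of 0] by simp
  ultimately show ?thesis by simp
qed

definition symmetric_part :: "real^'n^'n \<Rightarrow> real^'n^'n" where
  "symmetric_part N = (1/2) *\<^sub>R (N + transpose N)"

lemma transpose_symmetric_part: "transpose (symmetric_part N) = symmetric_part N"
  by (simp add: symmetric_part_def transpose_def Finite_Cartesian_Product.vec_eq_iff)

lemma quadratic_form_symmetric_part: "x \<bullet> (symmetric_part N *v x) = x \<bullet> (N *v x)"
proof -
  have "symmetric_part N *v x = (1/2) *\<^sub>R (N *v x + transpose N *v x)"
    unfolding symmetric_part_def scaleR_matrix_vector_assoc[symmetric]
    by (simp add: matrix_vector_mult_add_rdistrib)
  thus ?thesis using inner_transpose_matrix_vector[of x N x] by (simp add: inner_add_right)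
qed

text \<open>Along the segment from the symmetric part of N to N the quadratic form is unchanged, so
  the minor stays away from 0 and keeps the positive sign it has at the symmetric end.\<close>

lemma principal_minor_ge_power:
  fixes N :: "real^'n^'n"
  assumes c: "0 < c" and low: "\<And>x. supported_on I x \<Longrightarrow> c * (x \<bullet> x) \<le> x \<bullet> (N *v x)"
  shows "c ^ card I \<le> principal_minor N I"
proof -
  define S where "S = symmetric_part N"
  define f where "f t = principal_minor (S + t *\<^sub>R (N - S)) I" for t :: real
  have "x \<bullet> ((S + t *\<^sub>R (N - S)) *v x) = x \<bullet> (N *v x)" for t x
    using quadratic_form_symmetric_part[of x N]
    by (simp add: S_def matrix_vector_mult_add_rdistrib matrix_vector_mult_diff_rdistrib
        scaleR_matrix_vector_assoc[symmetric] inner_add_right inner_diff_right)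
  hence abs_f: "c ^ card I \<le> \<bar>f t\<bar>" for t
    unfolding f_def using low by (intro abs_principal_minor_ge_power[OF c]) simp
  have "0 < f 0"
    unfolding f_def using low
    by (simp add: S_def principal_minor_pos_symmetric[OF transpose_symmetric_part c]
        quadratic_form_symmetric_part)
  moreover have "continuous_on {0..1} f" unfolding f_def by (rule continuous_on_principal_minor_affine)
  ultimately have "0 \<le> f 1"
  proof (rule_tac ccontr)
    assume "0 < f 0" "continuous_on {0..1} f" "\<not> 0 \<le> f 1"
    then obtain t where "f t = 0" using IVT2'[of f 1 0 0] by auto
    thus False using abs_f[of t] zero_less_power[OF c, of "card I"] by simp
  qed
  thus ?thesis using abs_f[of 1] by (simp add: f_def)
qed

text \<open>An odd-dimensional principal minor vanishes at some real shift: it is positive at 0 and,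
  by the lower bound for the shifted matrix, negative beyond the largest Rayleigh value.\<close>

lemma principal_minor_shift_root:
  fixes N :: "real^'n^'n"
  assumes odd: "odd (card I)" and pos: "0 < principal_minor N I" and C: "0 \<le> C"
    and up: "\<And>x. supported_on I x \<Longrightarrow> x \<bullet> (N *v x) \<le> C * (x \<bullet> x)"
  obtains t where "0 \<le> t" "principal_minor (N - Finite_Cartesian_Product.mat t) I = 0"
proof -
  define g where "g t = principal_minor (N - Finite_Cartesian_Product.mat t) I" for t
  have "1 ^ card I \<le> principal_minor (Finite_Cartesian_Product.mat (C + 1) - N) I"
  proof (rule principal_minor_ge_power)
    fix x :: "real^'n" assume "supported_on I x"
    thus "1 * (x \<bullet> x) \<le> x \<bullet> ((Finite_Cartesian_Product.mat (C + 1) - N) *v x)"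
      using up by (simp add: matrix_vector_mult_diff_rdistrib matrix_vector_mult_mat inner_diff_right algebra_simps)
  qed simp
  hence "g (C + 1) < 0"
    using principal_minor_uminus[of "Finite_Cartesian_Product.mat (C + 1) - N" I] odd by (simp add: g_def)
  moreover have "N - Finite_Cartesian_Product.mat t = N + t *\<^sub>R (- Finite_Cartesian_Product.mat 1)" for t
    by (simp add: Finite_Cartesian_Product.mat_def Finite_Cartesian_Product.vec_eq_iff)
  hence "continuous_on {0..C + 1} g"
    unfolding g_def by (simp only: continuous_on_principal_minor_affine)
  ultimately obtain t where "0 \<le> t" "g t = 0"
    using IVT2'[of g "C + 1" 0 0] pos C by (auto simp: g_def)
  thus thesis using that by (simp add: g_def)
qed

lemma cmod_le_sqrt_one_plus_square:
  fixes b :: complex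
  assumes "c \<le> Re b" "Re b \<le> C" "\<bar>Im b\<bar> \<le> \<delta> * c" "0 < c" "0 \<le> \<delta>"
  shows "cmod b \<le> sqrt (1 + \<delta>\<^sup>2) * C"
proof -
  have "\<bar>Im b\<bar> \<le> \<delta> * Re b" using assms by (meson mult_left_mono order_trans)
  hence "\<bar>Im b\<bar>\<^sup>2 \<le> (\<delta> * Re b)\<^sup>2" by (rule power_mono) simp
  hence "(Im b)\<^sup>2 \<le> (\<delta> * Re b)\<^sup>2" by simp
  hence "(Re b)\<^sup>2 + (Im b)\<^sup>2 \<le> (1 + \<delta>\<^sup>2) * (Re b)\<^sup>2" by (simp add: power_mult_distrib algebra_simps)
  also have "\<dots> \<le> (1 + \<delta>\<^sup>2) * C\<^sup>2" using assms by (intro mult_left_mono power_mono) auto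
  finally have "cmod b \<le> sqrt ((1 + \<delta>\<^sup>2) * C\<^sup>2)" unfolding cmod_def by (rule real_sqrt_le_mono)
  moreover have "0 \<le> C" using assms by linarith
  ultimately show ?thesis by (simp add: real_sqrt_mult)
qed

lemma principal_minor_le_power:
  fixes N :: "real^'n^'n"
  assumes c: "0 < c" and \<delta>: "0 \<le> \<delta>" and \<beta>: "0 \<le> \<beta>" "\<beta> \<le> \<delta> * c" and cC: "c \<le> C"
    and low: "\<And>x. supported_on I x \<Longrightarrow> c * (x \<bullet> x) \<le> x \<bullet> (N *v x)"
    and up: "\<And>x. supported_on I x \<Longrightarrow> x \<bullet> (N *v x) \<le> C * (x \<bullet> x)"
    and anti: "\<And>x y. supported_on I x \<Longrightarrow> supported_on I y \<Longrightarrow>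
                 \<bar>x \<bullet> (N *v y) - y \<bullet> (N *v x)\<bar> \<le> 2 * \<beta> * norm x * norm y"
  shows "principal_minor N I \<le> (1 + \<delta>\<^sup>2) ^ (card I div 2) * C ^ card I"
proof -
  have pos: "0 < principal_minor N I"
    using principal_minor_ge_power[where I=I, OF c low] zero_less_power[OF c, of "card I"] by linarith
  obtain bs where bs: "length bs = card I"
    "\<forall>t. complex_of_real (principal_minor (N - Finite_Cartesian_Product.mat t) I)
          = (\<Prod>b\<leftarrow>bs. b - complex_of_real t)"
    "\<forall>b\<in>set bs. rayleigh_value_on N I b"
    using principal_minor_factorization[where N=N and I=I] by blast
  define K where "K = sqrt (1 + \<delta>\<^sup>2) * C"
  have re: "Re b \<le> C" and norm_b: "norm b \<le> K" if "b \<in> set bs" for b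
  proof -
    have rv: "rayleigh_value_on N I b" using bs(3) that by blast
    show "Re b \<le> C" by (rule rayleigh_value_on_Re_le[OF rv up])
    moreover have "\<bar>Im b\<bar> \<le> \<delta> * c" using rayleigh_value_on_abs_Im_le[OF rv \<beta>(1) anti] \<beta>(2) by linarith
    ultimately show "norm b \<le> K"
      unfolding K_def using rayleigh_value_on_Re_ge[OF rv low] c \<delta> by (intro cmod_le_sqrt_one_plus_square)
  qed
  have "prod_list bs = complex_of_real (principal_minor N I)" using bs(2)[rule_format, of 0] by simp
  hence minor: "principal_minor N I = norm (prod_list bs)" using pos by simp
  have K_pow: "K ^ (2 * m) = (1 + \<delta>\<^sup>2) ^ m * C ^ (2 * m)" for m
    by (simp add: K_def power_mult_distrib power_mult)
  show ?thesis
  proof (cases "even (card I)")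
    case True
    then obtain m where m: "card I = 2 * m" by (auto elim: evenE)
    have "norm (prod_list bs) \<le> K ^ length bs" by (rule norm_prod_list_le_power) (rule norm_b)
    thus ?thesis using m bs(1) K_pow by (simp add: minor)
  next
    case False
    then obtain m where m: "card I = 2 * m + 1" by (auto elim: oddE)
    obtain t where t: "0 \<le> t" "principal_minor (N - Finite_Cartesian_Product.mat t) I = 0"
      using principal_minor_shift_root[OF False pos _ up] c cC by (metis order_trans less_imp_le)
    hence t_root: "complex_of_real t \<in> set bs" using bs(2)[rule_format, of t] by (auto simp: prod_list_zero_iff)
    hence "norm (complex_of_real t) \<le> C" using re[OF t_root] t(1) by simp
    hence "norm (prod_list bs) \<le> C * K ^ (length bs - 1)"
      using c cC by (intro norm_prod_list_le_power_member[OF norm_b t_root]) auto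
    thus ?thesis using m bs(1) K_pow by (simp add: minor ac_simps)
  qed
qed

section \<open>Eigenvalue bounds for admissible solutions\<close>

lemma card_subsets_eq_choose: "card {I::'n::finite set. card I = k} = CARD('n) choose k"
  using n_subsets[of "UNIV :: 'n set" k] by simp

lemma S_k_ge_power_lambda_min:
  fixes W B :: "real^'n^'n"
  assumes sym: "transpose W = W" and skew: "transpose B = - B" and pos: "0 < lambda_min W"
  shows "real (CARD('n) choose k) * lambda_min W ^ k \<le> S_k k (W - B)"
proof -
  have "lambda_min W ^ card I \<le> principal_minor (W - B) I" for I
    using pos lambda_min_le_quadratic_form[OF sym]
    by (intro principal_minor_ge_power) (simp_all add: quadratic_form_diff_skew[OF skew])
  hence "(\<Sum>I::'n set | card I = k. lambda_min W ^ k) \<le> S_k k (W - B)"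
    unfolding S_k_def by (intro sum_mono) auto
  thus ?thesis by (simp add: card_subsets_eq_choose)
qed

lemma abs_inner_antisym_le_onorm:
  fixes W B :: "real^'n^'n"
  assumes sym: "transpose W = W" and skew: "transpose B = - B"
  shows "\<bar>x \<bullet> ((W - B) *v y) - y \<bullet> ((W - B) *v x)\<bar> \<le> 2 * onorm ((*v) B) * norm x * norm y"
proof -
  have "\<bar>x \<bullet> ((W - B) *v y) - y \<bullet> ((W - B) *v x)\<bar> = 2 * \<bar>x \<bullet> (B *v y)\<bar>"
    using inner_symmetric_matrix_vector[OF sym, of x y] inner_skew_matrix_vector[OF skew, of y x]
    by (simp add: matrix_vector_mult_diff_rdistrib inner_diff_right)
  also have "\<dots> \<le> 2 * (norm x * norm (B *v y))" using Cauchy_Schwarz_ineq2[of x "B *v y"] by simp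
  also have "\<dots> \<le> 2 * (norm x * (onorm ((*v) B) * norm y))"
    using onorm[OF matrix_vector_mul_bounded_linear, of B y] by (simp add: mult_left_mono)
  finally show ?thesis by (simp add: ac_simps)
qed

lemma S_k_le_power_lambda_max:
  fixes W B :: "real^'n^'n"
  assumes sym: "transpose W = W" and skew: "transpose B = - B" and pos: "0 < lambda_min W"
    and \<delta>: "0 \<le> \<delta>" and small: "onorm ((*v) B) \<le> \<delta> * lambda_min W"
  shows "S_k k (W - B) \<le> real (CARD('n) choose k) * ((1 + \<delta>\<^sup>2) ^ (k div 2) * lambda_max W ^ k)"
proof -
  have "principal_minor (W - B) I \<le> (1 + \<delta>\<^sup>2) ^ (card I div 2) * lambda_max W ^ card I" for I
  proof (rule principal_minor_le_power[OF pos \<delta> onorm_pos_le[OF matrix_vector_mul_bounded_linear] small])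
    show "lambda_min W \<le> lambda_max W" by (rule lambda_min_le_lambda_max[OF sym])
  qed (simp_all add: quadratic_form_diff_skew[OF skew] lambda_min_le_quadratic_form[OF sym]
      quadratic_form_le_lambda_max[OF sym] abs_inner_antisym_le_onorm[OF sym skew])
  hence "S_k k (W - B) \<le> (\<Sum>I::'n set | card I = k. (1 + \<delta>\<^sup>2) ^ (k div 2) * lambda_max W ^ k)"
    unfolding S_k_def by (intro sum_mono) auto
  thus ?thesis by (simp add: card_subsets_eq_choose)
qed

lemma lambda_min_le_root_S_k:
  fixes W B :: "real^'n^'n"
  assumes sym: "transpose W = W" and skew: "transpose B = - B" and pos: "0 < lambda_min W"
    and k: "0 < k" "k \<le> CARD('n)" and F: "S_k k (W - B) \<le> F"
  shows "lambda_min W \<le> root k (F / real (CARD('n) choose k))"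
proof -
  have "real (CARD('n) choose k) * lambda_min W ^ k \<le> F"
    using S_k_ge_power_lambda_min[OF sym skew pos, of k] F by linarith
  hence "lambda_min W ^ k \<le> F / real (CARD('n) choose k)"
    using k(2) by (simp add: field_simps)
  hence "root k (lambda_min W ^ k) \<le> root k (F / real (CARD('n) choose k))"
    by (rule real_root_le_mono[OF k(1)])
  also have "root k (lambda_min W ^ k) = lambda_min W" using k(1) pos by (simp add: real_root_pos_unique)
  finally show ?thesis .
qed

lemma root_S_k_le_lambda_max:
  fixes W B :: "real^'n^'n"
  assumes sym: "transpose W = W" and skew: "transpose B = - B" and pos: "0 < lambda_min W"
    and k: "0 < k" "k \<le> CARD('n)" and \<delta>: "0 \<le> \<delta>" and small: "onorm ((*v) B) \<le> \<delta> * lambda_min W"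
    and F: "F \<le> S_k k (W - B)"
  shows "root k (F / ((1 + \<delta>\<^sup>2) ^ (k div 2) * real (CARD('n) choose k))) \<le> lambda_max W"
proof -
  have "0 < (1 + \<delta>\<^sup>2) ^ (k div 2) * real (CARD('n) choose k)"
    using k(2) by (simp add: add_pos_nonneg)
  hence "F / ((1 + \<delta>\<^sup>2) ^ (k div 2) * real (CARD('n) choose k)) \<le> lambda_max W ^ k"
    using S_k_le_power_lambda_max[OF sym skew pos \<delta> small, of k] F
    by (simp add: pos_divide_le_eq ac_simps)
  hence "root k (F / ((1 + \<delta>\<^sup>2) ^ (k div 2) * real (CARD('n) choose k))) \<le> root k (lambda_max W ^ k)"
    by (rule real_root_le_mono[OF k(1)])
  also have "root k (lambda_max W ^ k) = lambda_max W"
    using k(1) pos lambda_min_le_lambda_max[OF sym] by (simp add: real_root_pos_unique)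
  finally show ?thesis .
qed

lemma lambda_u_le_lambda_min:
  fixes W :: "real^'n \<Rightarrow> real^'n^'n"
  assumes "compact S" "continuous_on S W" "\<And>x. x \<in> S \<Longrightarrow> transpose (W x) = W x" "x \<in> S"
  shows "lambda_u S W \<le> lambda_min (W x)"
proof -
  obtain M where M: "\<And>y. y \<in> S \<Longrightarrow> norm (W y) \<le> M"
    using compact_imp_bounded[OF compact_continuous_image[OF assms(2,1)]] unfolding bounded_iff by blast
  have "- (real CARD('n) * real CARD('n) * M) \<le> lambda_min (W y)" if "y \<in> S" for y
  proof -
    have "real CARD('n) * real CARD('n) * norm (W y) \<le> real CARD('n) * real CARD('n) * M"
      using M[OF that] by (intro mult_left_mono) simp_all
    thus ?thesis using lambda_min_ge_minus_norm[OF assms(3)[OF that]] by linarith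
  qed
  hence "bdd_below ((\<lambda>y. lambda_min (W y)) ` S)" by (intro bdd_belowI2)
  thus ?thesis unfolding lambda_u_def using assms(4) by (rule cINF_lower)
qed

lemma gamma_admissible_lambda_max_le:
  assumes "gamma_admissible g S W" "x \<in> S"
    and "\<And>y. y \<in> S \<Longrightarrow> 0 < lambda_min (W y) \<and> lambda_min (W y) \<le> lambda_max (W y)"
  shows "g * lambda_max (W x) \<le> lambda_min (W x)"
proof -
  have "bdd_below ((\<lambda>y. lambda_min (W y) / lambda_max (W y)) ` S)"
    using assms(3) by (intro bdd_belowI2[of _ 0]) (meson divide_nonneg_nonneg less_imp_le order_trans)
  hence "gamma_u S W \<le> lambda_min (W x) / lambda_max (W x)"
    unfolding gamma_u_def using assms(2) by (rule cINF_lower)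
  moreover have "0 < lambda_max (W x)" using assms(2,3) by force
  ultimately show ?thesis
    using assms(1) unfolding gamma_admissible_def by (meson order_trans pos_le_divide_eq)
qed

lemma onorm_le_mu_B:
  fixes B :: "real^'n \<Rightarrow> real \<Rightarrow> real^'n \<Rightarrow> real^'n^'n"
  assumes "bounded ((\<lambda>(x, z, p). B x z p) ` D)" "(x, z, p) \<in> D"
  shows "onorm ((*v) (B x z p)) \<le> mu_B D B"
proof -
  obtain M where M: "\<And>t. t \<in> D \<Longrightarrow> norm ((\<lambda>(x, z, p). B x z p) t) \<le> M"
    using assms(1) unfolding bounded_iff by blast
  have "onorm ((*v) ((\<lambda>(x, z, p). B x z p) t)) \<le> real CARD('n) * real CARD('n) * M" if "t \<in> D" for t
  proof (rule onorm_le_matrix_component)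
    show "\<bar>(\<lambda>(x, z, p). B x z p) t $ i $ j\<bar> \<le> M" for i j
      using M[OF that] by (meson component_le_norm_cart Finite_Cartesian_Product.norm_nth_le order_trans)
  qed
  hence "bdd_above ((\<lambda>t. onorm (\<lambda>v. (case t of (x, z, p) \<Rightarrow> B x z p) *v v)) ` D)"
    by (intro bdd_aboveI2) (simp add: case_prod_unfold)
  from cSUP_upper[OF assms(2) this] show ?thesis by (simp add: mu_B_def)
qed

lemma delta_admissible_onorm_le:
  fixes B :: "real^'n \<Rightarrow> real \<Rightarrow> real^'n \<Rightarrow> real^'n^'n"
  assumes "delta_admissible \<delta> S W B" "bounded ((\<lambda>(x, z, p). B x z p) ` (S \<times> UNIV \<times> UNIV))"
    and "0 \<le> \<delta>" "x \<in> S" "lambda_u S W \<le> lambda_min (W x)"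
  shows "onorm ((*v) (B x z p)) \<le> \<delta> * lambda_min (W x)"
proof -
  have "onorm ((*v) (B x z p)) \<le> mu_B (S \<times> UNIV \<times> UNIV) B"
    using assms(2,4) by (intro onorm_le_mu_B) auto
  also have "\<dots> \<le> \<delta> * lambda_u S W" using assms(1) by (simp add: delta_admissible_def)
  also have "\<dots> \<le> \<delta> * lambda_min (W x)" using assms(3,5) by (rule mult_left_mono[rotated])
  finally show ?thesis .
qed

lemma INF_le_and_le_SUP_compact:
  fixes g :: "'a::topological_space \<Rightarrow> real"
  assumes "compact K" "continuous_on K g" "t \<in> K"
  shows "(INF s\<in>K. g s) \<le> g t \<and> g t \<le> (SUP s\<in>K. g s)"
proof -
  have "bounded (g ` K)" using compact_imp_bounded[OF compact_continuous_image[OF assms(2,1)]] .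
  thus ?thesis
    using assms(3) by (auto intro: cINF_lower cSUP_upper bounded_imp_bdd_above bounded_imp_bdd_below)
qed

lemma INF_le_and_le_SUP_bounded_jets:
  fixes f :: "real^'n \<Rightarrow> real \<Rightarrow> real^'n \<Rightarrow> real" and S :: "(real^'n) set" and M0 M1 :: real
  defines "K \<equiv> {(x, z, p). x \<in> S \<and> \<bar>z\<bar> \<le> M0 \<and> norm p \<le> M1}"
  assumes "compact S" "continuous_on (S \<times> UNIV \<times> UNIV) (\<lambda>(x, z, p). f x z p)"
    and "x \<in> S" "\<bar>z\<bar> \<le> M0" "norm p \<le> M1"
  shows "(INF t\<in>K. case t of (x, z, p) \<Rightarrow> f x z p) \<le> f x z p \<and>
         f x z p \<le> (SUP t\<in>K. case t of (x, z, p) \<Rightarrow> f x z p)"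
proof -
  have "K = S \<times> cball 0 M0 \<times> cball 0 M1" by (auto simp: K_def)
  hence "compact K" using assms(2) by (auto intro!: compact_Times)
  moreover have "continuous_on K (\<lambda>(x, z, p). f x z p)"
    by (rule continuous_on_subset[OF assms(3)]) (auto simp: K_def)
  moreover have "(x, z, p) \<in> K" using assms(4-6) by (simp add: K_def)
  ultimately show ?thesis using INF_le_and_le_SUP_compact by fastforce
qed

theorem proposition1p7:
  fixes \<Omega> :: "(real^'n) set"
    and k :: nat
    and A B :: "real^'n \<Rightarrow> real \<Rightarrow> real^'n \<Rightarrow> real^'n^'n"
    and f :: "real^'n \<Rightarrow> real \<Rightarrow> real^'n \<Rightarrow> real"
    and u :: "real^'n \<Rightarrow> real"
    and Du :: "real^'n \<Rightarrow> real^'n"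
    and D2u :: "real^'n \<Rightarrow> real^'n^'n"
    and M0 M1 f0 f1 :: real
  assumes k: "2 \<le> k" "k \<le> CARD('n)"
    and dom: "open \<Omega>" "connected \<Omega>" "\<Omega> \<noteq> {}" "bounded \<Omega>"
    and A_cont: "continuous_on (closure \<Omega> \<times> UNIV \<times> UNIV) (\<lambda>(x, z, p). A x z p)"
    and A_sym: "\<And>x z p. x \<in> closure \<Omega> \<Longrightarrow> transpose (A x z p) = A x z p"
    and f_cont: "continuous_on (closure \<Omega> \<times> UNIV \<times> UNIV) (\<lambda>(x, z, p). f x z p)"
    and f_pos: "\<And>x z p. x \<in> closure \<Omega> \<Longrightarrow> f x z p > 0"
    and B_cont: "continuous_on (closure \<Omega> \<times> UNIV \<times> UNIV) (\<lambda>(x, z, p). B x z p)"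
    and B_bdd: "bounded ((\<lambda>(x, z, p). B x z p) ` (closure \<Omega> \<times> UNIV \<times> UNIV))"
    and B_skew: "\<And>x z p. x \<in> closure \<Omega> \<Longrightarrow> transpose (B x z p) = - B x z p"
    and u_C0: "continuous_on (closure \<Omega>) u"
    and u_D1: "\<And>x. x \<in> \<Omega> \<Longrightarrow> (u has_derivative (\<lambda>h. Du x \<bullet> h)) (at x)"
    and u_C1: "continuous_on (closure \<Omega>) Du"
    and u_D2: "\<And>x. x \<in> \<Omega> \<Longrightarrow> (Du has_derivative (\<lambda>h. D2u x *v h)) (at x)"
    and u_C2: "continuous_on (closure \<Omega>) D2u"
    and strict: "strictly_admissible (closure \<Omega>) (\<lambda>x. D2u x - A x (u x) (Du x))"
    and eq: "\<And>x. x \<in> closure \<Omega> \<Longrightarrow>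
              S_k k (D2u x - A x (u x) (Du x) - B x (u x) (Du x)) = f x (u x) (Du x)"
    and M: "M0 > 0" "M1 > 0"
    and u_bd: "\<And>x. x \<in> closure \<Omega> \<Longrightarrow> \<bar>u x\<bar> \<le> M0"
    and Du_bd: "\<And>x. x \<in> closure \<Omega> \<Longrightarrow> norm (Du x) \<le> M1"
    and f0_def: "f0 = (INF t\<in>{(x, z, p). x \<in> closure \<Omega> \<and> \<bar>z\<bar> \<le> M0 \<and> norm p \<le> M1}.
                         (case t of (x, z, p) \<Rightarrow> f x z p))"
    and f1_def: "f1 = (SUP t\<in>{(x, z, p). x \<in> closure \<Omega> \<and> \<bar>z\<bar> \<le> M0 \<and> norm p \<le> M1}.
                         (case t of (x, z, p) \<Rightarrow> f x z p))"
  shows "(\<forall>x\<in>closure \<Omega>.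
           0 < lambda_min (D2u x - A x (u x) (Du x)) \<and>
           lambda_min (D2u x - A x (u x) (Du x)) \<le> root k (f1 / real (CARD('n) choose k))) \<and>
         (\<forall>\<delta>. 0 < \<delta> \<and> \<delta> < 1 \<and>
           delta_admissible \<delta> (closure \<Omega>) (\<lambda>x. D2u x - A x (u x) (Du x)) B \<longrightarrow>
           (\<forall>x\<in>closure \<Omega>.
              root k (f0 / ((1 + \<delta>\<^sup>2) ^ (k div 2) * real (CARD('n) choose k)))
                \<le> lambda_max (D2u x - A x (u x) (Du x)))) \<and>
         (\<forall>g. 0 < g \<and> g < 1 \<and>
           gamma_admissible g (closure \<Omega>) (\<lambda>x. D2u x - A x (u x) (Du x)) \<longrightarrow>
           (\<forall>x\<in>closure \<Omega>.
              lambda_max (D2u x - A x (u x) (Du x)) \<le> (1 / g) * root k (f1 / real (CARD('n) choose k)))) \<and>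
         (\<forall>\<delta> g. 0 < \<delta> \<and> \<delta> < 1 \<and> 0 < g \<and> g < 1 \<and>
           delta_admissible \<delta> (closure \<Omega>) (\<lambda>x. D2u x - A x (u x) (Du x)) B \<and>
           gamma_admissible g (closure \<Omega>) (\<lambda>x. D2u x - A x (u x) (Du x)) \<longrightarrow>
           (\<forall>x\<in>closure \<Omega>.
              g * root k (f0 / ((1 + \<delta>\<^sup>2) ^ (k div 2) * real (CARD('n) choose k)))
                \<le> lambda_min (D2u x - A x (u x) (Du x)) \<and>
              lambda_min (D2u x - A x (u x) (Du x)) \<le> root k (f1 / real (CARD('n) choose k)) \<and>
              root k (f0 / ((1 + \<delta>\<^sup>2) ^ (k div 2) * real (CARD('n) choose k)))
                \<le> lambda_max (D2u x - A x (u x) (Du x)) \<and>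
              lambda_max (D2u x - A x (u x) (Du x)) \<le> (1 / g) * root k (f1 / real (CARD('n) choose k))))"
proof -
  define C where "C = closure \<Omega>"
  define W where "W x = D2u x - A x (u x) (Du x)" for x
  define Bu where "Bu x = B x (u x) (Du x)" for x
  define c where "c = real (CARD('n) choose k)"
  have sym: "transpose (W x) = W x" if "x \<in> C" for x
    using hessian_symmetric_on_closure[OF dom(1) u_D1 u_D2 u_C2, of x] A_sym[of x] that
    by (simp add: W_def C_def transpose_diff)
  have skew: "transpose (Bu x) = - Bu x" if "x \<in> C" for x using B_skew that by (simp add: Bu_def C_def)
  have "continuous_on C (\<lambda>x. (\<lambda>(x, z, p). A x z p) (x, u x, Du x))"
    using u_C0 u_C1 by (intro continuous_on_compose2[OF A_cont] continuous_intros) (auto simp: C_def)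
  hence "continuous_on C W" unfolding W_def using u_C2 by (intro continuous_intros) (simp_all add: C_def)
  moreover have "compact C" unfolding C_def using dom(4) by (simp add: compact_eq_bounded_closed bounded_closure)
  ultimately have lu: "lambda_u C W \<le> lambda_min (W x)" if "x \<in> C" for x
    using lambda_u_le_lambda_min sym that by blast
  hence pos: "0 < lambda_min (W x)" if "x \<in> C" for x
    using strict that by (fastforce simp: strictly_admissible_def W_def[abs_def] C_def)
  have spectrum: "0 < lambda_min (W x) \<and> lambda_min (W x) \<le> lambda_max (W x)" if "x \<in> C" for x
    using pos lambda_min_le_lambda_max[OF sym] that by blast
  have S_k: "f0 \<le> S_k k (W x - Bu x) \<and> S_k k (W x - Bu x) \<le> f1" if "x \<in> C" for x
    using INF_le_and_le_SUP_bounded_jets[OF \<open>compact C\<close>, where f=f and z="u x" and p="Du x"] f_cont u_bd Du_bd eq that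
    by (simp add: f0_def f1_def W_def Bu_def C_def)
  have i: "lambda_min (W x) \<le> root k (f1 / c)" if "x \<in> C" for x
    unfolding c_def by (rule lambda_min_le_root_S_k[OF sym[OF that] skew[OF that] pos[OF that] _ k(2)])
      (use k(1) S_k[OF that] in auto)
  have ii: "root k (f0 / ((1 + \<delta>\<^sup>2) ^ (k div 2) * c)) \<le> lambda_max (W x)"
    if "0 < \<delta>" "delta_admissible \<delta> C W B" "x \<in> C" for \<delta> x
  proof -
    have small: "onorm ((*v) (Bu x)) \<le> \<delta> * lambda_min (W x)"
      unfolding Bu_def using that lu[OF that(3)] B_bdd by (intro delta_admissible_onorm_le) (auto simp: C_def)
    show ?thesis unfolding c_def
      by (rule root_S_k_le_lambda_max[OF sym[OF that(3)] skew[OF that(3)] pos[OF that(3)] _ k(2) _ small])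
        (use that(1) S_k[OF that(3)] k(1) in auto)
  qed
  have gamma: "g * lambda_max (W x) \<le> lambda_min (W x)" if "gamma_admissible g C W" "x \<in> C" for g x
    using gamma_admissible_lambda_max_le[OF that spectrum] .
  have iii: "lambda_max (W x) \<le> 1 / g * root k (f1 / c)"
    if "0 < g" "gamma_admissible g C W" "x \<in> C" for g x
    using gamma[OF that(2,3)] i[OF that(3)] that(1) by (simp add: field_simps)
  have iv: "g * root k (f0 / ((1 + \<delta>\<^sup>2) ^ (k div 2) * c)) \<le> lambda_min (W x)"
    if "0 < \<delta>" "0 < g" "delta_admissible \<delta> C W B" "gamma_admissible g C W" "x \<in> C" for \<delta> g x
    using mult_left_mono[OF ii[OF that(1,3,5)], of g] gamma[OF that(4,5)] that(2) by linarith
  have W: "\<And>x. D2u x - A x (u x) (Du x) = W x" by (simp add: W_def)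
  show ?thesis unfolding W C_def[symmetric] c_def[symmetric] using pos i ii iii iv by auto
qed

end
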